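(* Let $1\le k\le n-1$, let $X=\mathcal{O}_k$ be the manifold of involutions $S=2P-I$ with $P$ a projector of rank $k$ in $\mathbf{R}^n$, let $N\ge 2$ and let $\lambda_1,\dots,\lambda_N$ be non-zero real parameters with $\lambda_i\ne\pm\lambda_j$ for $i\neq j$. Let $R(\lambda,\mu)$ be the Yang-Baxter map of matrix soliton interaction on $X\times X$, and let $$T_i^{(N)}=R_{i\,i+N-1}R_{i\,i+N-2}\cdots R_{i\,i+1},\qquad i=1,\dots,N,$$ (indices modulo $N$, $R_{ij}=R_{ij}(\lambda_i,\lambda_j)$) be the corresponding transfer-maps of $X^N$. Then the transfer-dynamics is symplectic: each $T_i^{(N)}$ preserves (where it is defined) the symplectic form $$\Omega^{(N)}=\omega_{\lambda_1}\oplus\omega_{\lambda_2}\oplus\dots\oplus\omega_{\lambda_N}$$ on $X^N$.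
   Context: A projector $P$ ($P^2=P$) on $\mathbf{R}^n$ is determined by its kernel $K=\operatorname{Ker}P$ and image $L=\operatorname{Im}P$, with $K\oplus L=\mathbf{R}^n$. The map of matrix soliton interaction (arising from the interaction of two solitons of the matrix KdV equation $U_t+3UU_x+3U_xU+U_{xxx}=0$) is the partially defined map $R(\lambda_1,\lambda_2):(P_1,P_2)\mapsto(\tilde P_1,\tilde P_2)$, where $\tilde P_i$ is the projector with kernel $\tilde K_i$ and image $\tilde L_i$ given by $$\tilde K_1=\Bigl(I-\tfrac{2\lambda_2}{\lambda_1+\lambda_2}P_2\Bigr)K_1,\qquad \tilde K_2=\Bigl(I-\tfrac{2\lambda_1}{\lambda_1+\lambda_2}P_1\Bigr)K_2,$$ $$\tilde L_1=\Bigl(I+\tfrac{2\lambda_2}{\lambda_1-\lambda_2}P_2\Bigr)L_1,\qquad \tilde L_2=\Bigl(I+\tfrac{2\lambda_1}{\lambda_2-\lambda_1}P_1\Bigr)L_2 .$$ Equivalently, it is the solution of the re-factorisation problem $\phi_{\lambda_1}(S_1)\phi_{\lambda_2}(S_2)=\phi_{\lambda_2}(\tilde S_2)\phi_{\lambda_1}(\tilde S_1)$ for all $\zeta$, where $S=2P-I$ and $\phi_\lambda(S)=\zeta I+\lambda S=(\zeta-\lambda)I+2\lambda P$. In the case $k=1$, writing $P_i=p_i\otimes q_i/(p_i,q_i)$ with covectors $p_i$ and vectors $q_i$ defined up to scaling, the map is $$\tilde p_1=p_1+\frac{2\lambda_2(p_1,q_2)}{(\lambda_1-\lambda_2)(p_2,q_2)}p_2,\quad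 \tilde q_1=q_1+\frac{2\lambda_2(p_2,q_1)}{(\lambda_1-\lambda_2)(p_2,q_2)}q_2,$$ $$\tilde p_2=p_2+\frac{2\lambda_1(p_2,q_1)}{(\lambda_2-\lambda_1)(p_1,q_1)}p_1,\quad \tilde q_2=q_2+\frac{2\lambda_1(p_1,q_2)}{(\lambda_2-\lambda_1)(p_1,q_1)}q_1 .$$ $R_{ij}(\lambda_i,\lambda_j)$ denotes the map of $X^N$ acting as $R(\lambda_i,\lambda_j)$ on the $i$-th and $j$-th factors (in this order) and identically on the others; in compositions the rightmost map is applied first. Symplectic form $\omega_\lambda$: the Sklyanin bracket $\{L_1(\zeta),\otimes L_2(\eta)\}=\bigl[\frac{P_{12}}{\zeta-\eta},L_1(\zeta)\otimes L_2(\eta)\bigr]$ on the loop group $LGL(n,\mathbf{R})$ ($P_{12}$ the permutation of tensor factors), restricted to elements $L(\zeta)=A+\zeta I$, gives the Lie-Poisson bracket on $n\times n$ matrices $$\{A_{ij},A_{kl}\}=\delta_{il}A_{kj}-\delta_{kj}A_{il}.$$ For $\lambda\ne0$ the set $\{\lambda S: S\in\mathcal{O}_k\}$ is a symplectic leaf of this bracket, and $\omega_\lambda$ is the pull-back to $\mathcal{O}_k$ of the symplectic form of this leaf under $S\mapsto\lambda S$. *)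

theory Defs
  imports "HOL-Analysis.Analysis" "Berlekamp_Zassenhaus.Finite_Field"
begin

section \<open>Involutions and the matrix soliton map\<close>

definition projector :: "real^'n^'n \<Rightarrow> bool" where
  "projector P \<longleftrightarrow> P ** P = P"

definition mat_kernel :: "real^'n^'n \<Rightarrow> (real^'n) set" where
  "mat_kernel P = {v. P *v v = 0}"

definition mat_image :: "real^'n^'n \<Rightarrow> (real^'n) set" where
  "mat_image P = range (\<lambda>v. P *v v)"

definition involution_of :: "real^'n^'n \<Rightarrow> real^'n^'n" where
  "involution_of P = 2 *\<^sub>R P - mat 1"

definition projector_of :: "real^'n^'n \<Rightarrow> real^'n^'n" where
  "projector_of S = (1/2) *\<^sub>R (S + mat 1)"

definition involutions :: "nat \<Rightarrow> (real^'n^'n) set" where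
  "involutions k = {involution_of P |P. projector P \<and> rank P = k}"

definition is_projector_with :: "(real^'n) set \<Rightarrow> (real^'n) set \<Rightarrow> real^'n^'n \<Rightarrow> bool" where
  "is_projector_with K L P \<longleftrightarrow> projector P \<and> mat_kernel P = K \<and> mat_image P = L"

definition projector_with :: "(real^'n) set \<Rightarrow> (real^'n) set \<Rightarrow> real^'n^'n" where
  "projector_with K L = (THE P. is_projector_with K L P)"

lemma is_projector_with_unique:
  assumes "is_projector_with K L P" "is_projector_with K L Q"
  shows "P = Q"
proof -
  have PP: "P ** P = P" and QQ: "Q ** Q = Q"
    and ker: "mat_kernel P = mat_kernel Q" and im: "mat_image P = mat_image Q"
    using assms by (auto simp: is_projector_with_def projector_def)
  have "P *v v = Q *v v" for v
  proof -
    have "v - P *v v \<in> mat_kernel P"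
      by (simp add: mat_kernel_def matrix_vector_mult_diff_distrib matrix_vector_mul_assoc PP)
    then have "Q *v v = Q *v (P *v v)"
      unfolding ker by (simp add: mat_kernel_def matrix_vector_mult_diff_distrib)
    moreover have "P *v v \<in> mat_image Q"
      unfolding im[symmetric] by (simp add: mat_image_def)
    then obtain w where "P *v v = Q *v w"
      by (auto simp: mat_image_def)
    ultimately show ?thesis
      by (simp add: matrix_vector_mul_assoc QQ)
  qed
  then show ?thesis
    by (simp add: matrix_eq)
qed

lemma projector_with_eq:
  "is_projector_with K L P \<Longrightarrow> projector_with K L = P"
  unfolding projector_with_def by (blast intro: is_projector_with_unique)

text \<open>The map is partial: it is defined exactly when both pairs (kernel, image) produced by the
  formulas are kernel and image of a projector.\<close>

definition soliton_map ::
    "real \<Rightarrow> real \<Rightarrow> (real^'n^'n) \<times> (real^'n^'n) \<rightharpoonup> (real^'n^'n) \<times> (real^'n^'n)" where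
  "soliton_map l1 l2 = (\<lambda>(S1, S2).
     let P1 = projector_of S1; P2 = projector_of S2;
         K1 = (\<lambda>v. (mat 1 - (2 * l2 / (l1 + l2)) *\<^sub>R P2) *v v) ` mat_kernel P1;
         K2 = (\<lambda>v. (mat 1 - (2 * l1 / (l1 + l2)) *\<^sub>R P1) *v v) ` mat_kernel P2;
         L1 = (\<lambda>v. (mat 1 + (2 * l2 / (l1 - l2)) *\<^sub>R P2) *v v) ` mat_image P1;
         L2 = (\<lambda>v. (mat 1 + (2 * l1 / (l2 - l1)) *\<^sub>R P1) *v v) ` mat_image P2
     in if (\<exists>P. is_projector_with K1 L1 P) \<and> (\<exists>P. is_projector_with K2 L2 P)
        then Some (involution_of (projector_with K1 L1), involution_of (projector_with K2 L2))
        else None)"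


section \<open>Transfer maps\<close>

text \<open>The index set is the ring of integers modulo \<open>N\<close>, where \<open>N \<ge> 2\<close> is the cardinality of the
  type \<open>'m\<close> of class \<open>nontriv\<close>; the index \<open>N\<close> is identified with \<open>0\<close>.\<close>

definition phase_space :: "nat \<Rightarrow> ((real^'n^'n)^('m::nontriv mod_ring)) set" where
  "phase_space k = {S. \<forall>i. S $ i \<in> involutions k}"

definition factor_map ::
    "('m::nontriv mod_ring \<Rightarrow> real) \<Rightarrow> 'm mod_ring \<Rightarrow> 'm mod_ring \<Rightarrow>
     (real^'n^'n)^('m mod_ring) \<rightharpoonup> (real^'n^'n)^('m mod_ring)" where
  "factor_map l i j S =
     map_option (\<lambda>(A, B). \<chi> m. if m = i then A else if m = j then B else S $ m)
       (soliton_map (l i) (l j) (S $ i, S $ j))"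

primrec partial_transfer ::
    "('m::nontriv mod_ring \<Rightarrow> real) \<Rightarrow> 'm mod_ring \<Rightarrow> nat \<Rightarrow>
     (real^'n^'n)^('m mod_ring) \<rightharpoonup> (real^'n^'n)^('m mod_ring)" where
  "partial_transfer l i 0 = Some"
| "partial_transfer l i (Suc m) = factor_map l i (i + of_nat (Suc m)) \<circ>\<^sub>m partial_transfer l i m"

definition transfer_map ::
    "('m::nontriv mod_ring \<Rightarrow> real) \<Rightarrow> 'm mod_ring \<Rightarrow>
     (real^'n^'n)^('m mod_ring) \<rightharpoonup> (real^'n^'n)^('m mod_ring)" where
  "transfer_map l i = partial_transfer l i (CARD('m) - 1)"


section \<open>Symplectic forms\<close>

interpretation matrix_mult: bounded_bilinear "(**) :: real^'n^'n \<Rightarrow> real^'n^'n \<Rightarrow> real^'n^'n"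
  unfolding bilinear_conv_bounded_bilinear[symmetric] bilinear_def
  by (auto intro!: linearI simp: vec_eq_iff matrix_matrix_mult_def sum.distrib
      distrib_left distrib_right sum_distrib_left mult_ac)

text \<open>The value \<open>{A\<^sub>i\<^sub>j, A\<^sub>k\<^sub>l}\<close> of the Lie-Poisson bracket of two coordinate functions at \<open>A\<close>.\<close>

definition coord_bracket :: "real^'n^'n \<Rightarrow> 'n \<Rightarrow> 'n \<Rightarrow> 'n \<Rightarrow> 'n \<Rightarrow> real" where
  "coord_bracket A i j k l = (if i = l then A $ k $ j else 0) - (if k = j then A $ i $ l else 0)"

text \<open>A matrix \<open>F\<close> stands for the covector \<open>\<Sum>i j. F\<^sub>i\<^sub>j dA\<^sub>i\<^sub>j\<close>. If \<open>F\<close> and \<open>G\<close> are the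
  differentials of functions \<open>f\<close> and \<open>g\<close> at \<open>A\<close>, then \<open>poisson A F G = {f, g}(A)\<close>, and
  \<open>hamiltonian A G\<close> is the Hamiltonian vector \<open>{\<cdot>, g}\<close> at \<open>A\<close>.\<close>

definition poisson :: "real^'n^'n \<Rightarrow> real^'n^'n \<Rightarrow> real^'n^'n \<Rightarrow> real" where
  "poisson A F G =
     (\<Sum>i\<in>UNIV. \<Sum>j\<in>UNIV. \<Sum>k\<in>UNIV. \<Sum>l\<in>UNIV. F $ i $ j * G $ k $ l * coord_bracket A i j k l)"

definition hamiltonian :: "real^'n^'n \<Rightarrow> real^'n^'n \<Rightarrow> real^'n^'n" where
  "hamiltonian A G = (\<chi> i j. \<Sum>k\<in>UNIV. \<Sum>l\<in>UNIV. G $ k $ l * coord_bracket A i j k l)"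

text \<open>The symplectic form of the leaf through \<open>A\<close>. The tangent vectors of the leaf are the
  Hamiltonian vectors, and the value of the form on those of \<open>f\<close> and \<open>g\<close> is \<open>{f, g}(A)\<close>.\<close>

definition leaf_form :: "real^'n^'n \<Rightarrow> real^'n^'n \<Rightarrow> real^'n^'n \<Rightarrow> real" where
  "leaf_form A U V =
     (THE c. \<exists>F G. hamiltonian A F = U \<and> hamiltonian A G = V \<and> c = poisson A F G)"

lemma hamiltonian_eq:
  "hamiltonian A G = transpose G ** A - A ** transpose G"
proof -
  have "(\<Sum>k\<in>UNIV. \<Sum>l\<in>UNIV. G $ k $ l * coord_bracket A i j k l) =
        (\<Sum>k\<in>UNIV. G $ k $ i * A $ k $ j) - (\<Sum>l\<in>UNIV. A $ i $ l * G $ j $ l)" for i j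
  proof -
    have "(\<Sum>k\<in>UNIV. \<Sum>l\<in>UNIV. G $ k $ l * coord_bracket A i j k l) =
        (\<Sum>k\<in>UNIV. \<Sum>l\<in>UNIV. if i = l then G $ k $ l * A $ k $ j else 0) -
        (\<Sum>k\<in>UNIV. \<Sum>l\<in>UNIV. if k = j then G $ k $ l * A $ i $ l else 0)"
      unfolding coord_bracket_def sum_subtractf[symmetric]
      by (intro sum.cong refl) (simp add: right_diff_distrib)
    also have "(\<Sum>k\<in>UNIV. \<Sum>l\<in>UNIV. if k = j then G $ k $ l * A $ i $ l else 0) =
        (\<Sum>l\<in>UNIV. \<Sum>k\<in>UNIV. if k = j then G $ k $ l * A $ i $ l else 0)"
      by (rule sum.swap)
    finally show ?thesis
      by (simp add: mult.commute)
  qed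
  then show ?thesis
    by (simp add: hamiltonian_def matrix_matrix_mult_def transpose_def vec_eq_iff)
qed

lemma poisson_eq:
  "poisson A F G = (\<Sum>i\<in>UNIV. \<Sum>j\<in>UNIV. F $ i $ j * hamiltonian A G $ i $ j)"
  by (simp add: poisson_def hamiltonian_def sum_distrib_left mult.assoc)

lemma poisson_antisym: "poisson A F G = - poisson A G F"
proof -
  have tr: "poisson A F G = trace (transpose F ** hamiltonian A G)" for F G
    unfolding poisson_eq
    by (subst sum.swap) (simp add: trace_def matrix_matrix_mult_def transpose_def)
  have "trace (transpose F ** (transpose G ** A)) = trace (transpose G ** (A ** transpose F))"
    by (metis matrix_mul_assoc trace_mul_sym)
  moreover have "trace (transpose F ** (A ** transpose G)) = trace (transpose G ** (transpose F ** A))"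
    by (metis matrix_mul_assoc trace_mul_sym)
  ultimately show ?thesis
    by (simp add: tr hamiltonian_eq matrix_mult.diff_right trace_sub)
qed

lemma leaf_form_hamiltonian:
  "leaf_form A (hamiltonian A F) (hamiltonian A G) = poisson A F G"
  unfolding leaf_form_def
proof (rule the_equality)
  fix c assume "\<exists>F' G'. hamiltonian A F' = hamiltonian A F \<and>
    hamiltonian A G' = hamiltonian A G \<and> c = poisson A F' G'"
  then obtain F' G' where *: "hamiltonian A F' = hamiltonian A F"
    "hamiltonian A G' = hamiltonian A G" "c = poisson A F' G'" by blast
  have "poisson A F' G' = poisson A F' G"
    using * by (simp add: poisson_eq)
  also have "\<dots> = - poisson A G F'"
    by (rule poisson_antisym)
  also have "\<dots> = - poisson A G F"
    using * by (simp add: poisson_eq)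
  also have "\<dots> = poisson A F G"
    using poisson_antisym[of A F G] by simp
  finally show "c = poisson A F G" using * by simp
qed blast

text \<open>The pull-back of the leaf form under \<open>S \<mapsto> \<lambda>S\<close>, whose differential is \<open>U \<mapsto> \<lambda>U\<close>.\<close>

definition involution_form :: "real \<Rightarrow> real^'n^'n \<Rightarrow> real^'n^'n \<Rightarrow> real^'n^'n \<Rightarrow> real" where
  "involution_form l S U V = leaf_form (l *\<^sub>R S) (l *\<^sub>R U) (l *\<^sub>R V)"

definition phase_form ::
    "('m::nontriv mod_ring \<Rightarrow> real) \<Rightarrow> (real^'n^'n)^('m mod_ring) \<Rightarrow>
     (real^'n^'n)^('m mod_ring) \<Rightarrow> (real^'n^'n)^('m mod_ring) \<Rightarrow> real" where
  "phase_form l S U V = (\<Sum>i\<in>UNIV. involution_form (l i) (S $ i) (U $ i) (V $ i))"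

definition tangent_space :: "'a::real_normed_vector set \<Rightarrow> 'a \<Rightarrow> 'a set" where
  "tangent_space M x = {v. \<exists>c e. e > 0 \<and> (\<forall>t\<in>{-e<..<e}. c t \<in> M) \<and> c 0 = x \<and>
                                (c has_vector_derivative v) (at (0::real))}"

lemma involution_square:
  assumes "S \<in> involutions k" shows "S ** S = mat 1"
proof -
  obtain P where "S = involution_of P" "P ** P = P"
    using assms by (auto simp: involutions_def projector_def)
  then have "S ** S = 2 *\<^sub>R (2 *\<^sub>R P) - 2 *\<^sub>R P - 2 *\<^sub>R P + mat 1"
    by (simp only: involution_of_def matrix_mult.diff_left matrix_mult.diff_right
        matrix_mult.scaleR_left matrix_mult.scaleR_right matrix_mul_lid matrix_mul_rid) (simp add: vec_eq_iff)
  then show ?thesis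
    by (simp add: vec_eq_iff)
qed

lemma tangent_involutions:
  assumes "U \<in> tangent_space (involutions k) S"
  shows "U ** S + S ** U = 0"
proof -
  obtain c e where e: "e > 0" and c: "\<And>t. t \<in> {-e<..<e} \<Longrightarrow> c t \<in> involutions k"
    and c0: "c 0 = S" and d: "(c has_vector_derivative U) (at 0)"
    using assms unfolding tangent_space_def by blast
  have "((\<lambda>t. c t ** c t) has_vector_derivative c 0 ** U + U ** c 0) (at 0)"
    by (rule matrix_mult.has_vector_derivative[OF d d])
  moreover have "((\<lambda>t. c t ** c t) has_vector_derivative 0) (at 0)"
    by (rule has_vector_derivative_transform_within_open[of "\<lambda>t. mat 1" _ _ "{-e<..<e}"])
      (use e involution_square[OF c] in auto)
  ultimately show ?thesis
    using vector_derivative_unique_at c0 by (metis add.commute)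
qed

lemma involution_form_eq:
  assumes S: "S ** S = mat 1" and U: "U ** S + S ** U = 0" and V: "V ** S + S ** V = 0"
  shows "involution_form l S U V = - (l / 2) * trace (S ** U ** V)"
proof -
  have ham: "hamiltonian (l *\<^sub>R S) (- (1/2) *\<^sub>R transpose (S ** W)) = l *\<^sub>R W"
    if "W ** S + S ** W = 0" for W
  proof -
    have "S ** W ** S = - W"
    proof -
      have "W ** S = - (S ** W)" using that by (simp add: eq_neg_iff_add_eq_0)
      then show ?thesis
        by (simp add: matrix_mul_assoc[symmetric] matrix_mult.minus_right)
           (simp add: matrix_mul_assoc S)
    qed
    moreover have "S ** (S ** W) = W" by (simp add: matrix_mul_assoc S)
    moreover have "transpose (- (1/2) *\<^sub>R transpose M) = - (1/2) *\<^sub>R M" for M :: "real^'n^'n"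
      by (simp add: vec_eq_iff transpose_def)
    then have "transpose (- (1/2) *\<^sub>R transpose (S ** W)) = - (1/2) *\<^sub>R (S ** W)" .
    ultimately show ?thesis
      unfolding hamiltonian_eq
      by (simp only: matrix_mult.scaleR_left matrix_mult.scaleR_right) (simp add: vec_eq_iff field_simps)
  qed
  have "involution_form l S U V =
      poisson (l *\<^sub>R S) (- (1/2) *\<^sub>R transpose (S ** U)) (- (1/2) *\<^sub>R transpose (S ** V))"
    unfolding involution_form_def ham[OF U, symmetric] ham[OF V, symmetric]
    by (rule leaf_form_hamiltonian)
  also have "\<dots> = (\<Sum>i\<in>UNIV. \<Sum>j\<in>UNIV. - (l/2) * ((S ** U) $ j $ i * V $ i $ j))"
    unfolding poisson_eq ham[OF V] by (simp add: transpose_def mult_ac)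
  also have "\<dots> = - (l/2) * trace (S ** U ** V)"
    by (subst sum.swap)
      (simp only: trace_def matrix_matrix_mult_def[of "S ** U"] sum_distrib_left vec_lambda_beta)
  finally show ?thesis .
qed

text \<open>A partial map \<open>T\<close> of a submanifold \<open>M\<close> preserves a two-form \<open>\<Omega>\<close> on \<open>M\<close> where it is defined.
  The domain is required to be open in \<open>M\<close>, so that the derivative \<open>D\<close> is determined on tangent
  vectors of \<open>M\<close>.\<close>

definition preserves_form ::
    "'a::real_normed_vector set \<Rightarrow> ('a \<Rightarrow> 'a \<Rightarrow> 'a \<Rightarrow> real) \<Rightarrow> ('a \<rightharpoonup> 'a) \<Rightarrow> bool" where
  "preserves_form M \<Omega> T \<longleftrightarrow>
     openin (top_of_set M) (M \<inter> dom T) \<and>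
     (\<forall>x \<in> M \<inter> dom T. the (T x) \<in> M \<and>
        (\<exists>D. ((\<lambda>y. the (T y)) has_derivative D) (at x within M \<inter> dom T) \<and>
             (\<forall>u \<in> tangent_space M x. \<forall>v \<in> tangent_space M x.
                D u \<in> tangent_space M (the (T x)) \<and>
                \<Omega> (the (T x)) (D u) (D v) = \<Omega> x u v)))"

end

theory Submission
  imports Defs
begin

text \<open>On pairs of involutions the soliton map is a simultaneous conjugation. Put
  \<open>Y = l\<^sub>1 S\<^sub>1 + l\<^sub>2 S\<^sub>2\<close>. On the kernel of \<open>P\<^sub>1\<close>, where \<open>S\<^sub>1 = -1\<close>, the operator
  \<open>I - (2 l\<^sub>2 / (l\<^sub>1 + l\<^sub>2)) P\<^sub>2\<close> is a nonzero multiple of \<open>Y\<close>, and the same happens for the other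
  three operators in the formulas. So the new kernels and images are the \<open>Y\<close>-images of the old
  ones: the map is defined exactly where \<open>Y\<close> is invertible, and there it sends \<open>(S\<^sub>1, S\<^sub>2)\<close> to
  \<open>(Y S\<^sub>1 Y\<^sup>-\<^sup>1, Y S\<^sub>2 Y\<^sup>-\<^sup>1)\<close> (\<open>soliton_map_eq_conjugate\<close>). In particular the domain is open and the
  map is smooth on it.

  On tangent vectors of the involutions, which anticommute with \<open>S\<close>, the
  symplectic form is \<open>- (l/2) tr (S U V)\<close>. Conjugation by a constant matrix preserves it, but \<open>Y\<close>
  moves with the point. Let \<open>X = Y\<^sup>-\<^sup>1 dY(U)\<close> and \<open>Z = Y\<^sup>-\<^sup>1 dY(V)\<close>. The derivative of
  \<open>Y S Y\<^sup>-\<^sup>1\<close> is the conjugate of \<open>U + [X, S]\<close>, and expanding the trace gives the change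
  \<open>tr (X l V) - tr (l U Z) - tr (l S [Z, X])\<close> of the form on one factor. For fixed \<open>X\<close> and \<open>Z\<close> this is
  linear in \<open>(l S, l U, l V)\<close>; summing over the two factors turns these matrices into \<open>Y\<close>,
  \<open>dY(U) = Y X\<close> and \<open>dY(V) = Y Z\<close>, and the result
  \<open>tr (X Y Z) - tr (Y X Z) - tr (Y Z X) + tr (Y X Z)\<close> is zero by cyclicity of the trace
  (\<open>phase_form_exchange\<close>).

  A transfer map is a composition of such interactions, and preservation of a form is stable under
  composition of partial maps (\<open>preserves_form_comp\<close>).\<close>

section \<open>Conjugation of matrices\<close>

definition conjugate :: "real^'n^'n \<Rightarrow> real^'n^'n \<Rightarrow> real^'n^'n" where
  "conjugate Y A = Y ** A ** matrix_inv Y"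

lemma matrix_inv_cancel:
  fixes Y :: "real^'n^'n"
  assumes "invertible Y"
  shows "Y ** matrix_inv Y = mat 1" "matrix_inv Y ** Y = mat 1"
  using assms unfolding invertible_def matrix_inv_def by (auto intro: someI2_ex)

lemma matrix_inv_cancel_left:
  fixes Y :: "real^'n^'n"
  assumes "invertible Y"
  shows "Y ** (matrix_inv Y ** A) = A" "matrix_inv Y ** (Y ** A) = A"
  using assms by (simp_all add: matrix_mul_assoc matrix_inv_cancel)

lemma conjugate_mult:
  assumes "invertible Y"
  shows "conjugate Y A ** conjugate Y B = conjugate Y (A ** B)"
  using assms
  by (simp add: conjugate_def matrix_mul_assoc[symmetric] matrix_inv_cancel_left)

lemma trace_conjugate:
  assumes "invertible Y"
  shows "trace (conjugate Y A) = trace A"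
proof -
  have "trace (conjugate Y A) = trace (matrix_inv Y ** (Y ** A))"
    unfolding conjugate_def by (rule trace_mul_sym)
  then show ?thesis
    using assms by (simp add: matrix_inv_cancel_left)
qed

lemma conjugate_involution_of:
  assumes "invertible Y"
  shows "conjugate Y (involution_of P) = involution_of (conjugate Y P)"
  using assms
  by (simp add: conjugate_def involution_of_def matrix_mult.diff_left matrix_mult.diff_right
      matrix_mult.scaleR_left matrix_mult.scaleR_right matrix_inv_cancel)

lemma rank_conjugate:
  assumes "invertible Y"
  shows "rank (conjugate Y P) = rank P"
proof (rule antisym)
  show "rank (conjugate Y P) \<le> rank P"
    unfolding conjugate_def using rank_mul_le_left rank_mul_le_right order_trans by metis
  have "P = matrix_inv Y ** conjugate Y P ** Y"
    using assms
    by (simp add: conjugate_def matrix_mul_assoc[symmetric] matrix_inv_cancel_left matrix_inv_cancel)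
  then show "rank P \<le> rank (conjugate Y P)"
    using rank_mul_le_left rank_mul_le_right order_trans by metis
qed

lemma conjugate_in_involutions:
  assumes "invertible Y" "S \<in> involutions k"
  shows "conjugate Y S \<in> involutions k"
proof -
  obtain P where P: "S = involution_of P" "P ** P = P" "rank P = k"
    using assms(2) by (auto simp: involutions_def projector_def)
  have "projector (conjugate Y P)" "rank (conjugate Y P) = k"
    using P assms(1) by (simp_all add: projector_def conjugate_mult rank_conjugate)
  then show ?thesis
    using P assms(1) by (auto simp: involutions_def conjugate_involution_of)
qed

section \<open>The soliton map as a simultaneous conjugation\<close>

text \<open>A nonzero scalar does not change the image of a subspace. This removes the constants
  depending on \<open>l\<^sub>1 \<plusminus> l\<^sub>2\<close> from the kernels and images produced by the soliton map.\<close>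

lemma image_eq_if_scalar_multiple:
  fixes f g :: "'a::real_vector \<Rightarrow> 'b::real_vector"
  assumes V: "subspace V" and g: "linear g" and c: "c \<noteq> 0"
    and fg: "\<And>v. v \<in> V \<Longrightarrow> f v = c *\<^sub>R g v"
  shows "f ` V = g ` V"
proof (intro equalityI image_subsetI)
  fix v assume v: "v \<in> V"
  have "f v = g (c *\<^sub>R v)"
    using fg[OF v] g by (simp add: linear_cmul)
  then show "f v \<in> g ` V"
    using V v by (auto intro: subspace_scale)
  have w: "(1/c) *\<^sub>R v \<in> V"
    using V v by (rule subspace_scale)
  have "g v = f ((1/c) *\<^sub>R v)"
    unfolding fg[OF w] using g c by (simp add: linear_cmul)
  then show "g v \<in> f ` V"
    using w by blast
qed

lemma subspace_mat_kernel: "subspace (mat_kernel P)"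
  by (auto simp: subspace_def mat_kernel_def matrix_vector_right_distrib matrix_vector_mult_scaleR)

lemma subspace_mat_image: "subspace (mat_image P)"
  unfolding mat_image_def
  by (intro linear_subspace_image[OF matrix_vector_mul_linear] subspace_UNIV)

text \<open>On \<open>ker P\<close> the involution of \<open>P\<close> is \<open>-1\<close>, so \<open>Y = a (2P - 1) + b (2Q - 1)\<close> acts there as
  \<open>- (a + b) + 2 b Q\<close>, which is \<open>- (a + b)\<close> times the operator on the left.\<close>

lemma soliton_kernel:
  assumes "a + b \<noteq> 0"
  shows "(\<lambda>v. (mat 1 - (2 * b / (a + b)) *\<^sub>R Q) *v v) ` mat_kernel P =
         (\<lambda>v. (a *\<^sub>R involution_of P + b *\<^sub>R involution_of Q) *v v) ` mat_kernel P"
proof (rule image_eq_if_scalar_multiple[OF subspace_mat_kernel matrix_vector_mul_linear])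
  show "- 1 / (a + b) \<noteq> 0" using assms by simp
  fix v assume "v \<in> mat_kernel P"
  then have "(a *\<^sub>R involution_of P + b *\<^sub>R involution_of Q) *v v =
      - (a + b) *\<^sub>R v + (2 * b) *\<^sub>R (Q *v v)"
    by (simp add: mat_kernel_def involution_of_def matrix_vector_mult_add_rdistrib
        matrix_vector_mult_diff_rdistrib scaleR_matrix_vector_assoc[symmetric] algebra_simps)
  then show "(mat 1 - (2 * b / (a + b)) *\<^sub>R Q) *v v =
      (- 1 / (a + b)) *\<^sub>R ((a *\<^sub>R involution_of P + b *\<^sub>R involution_of Q) *v v)"
    using assms
    by (simp add: matrix_vector_mult_diff_rdistrib scaleR_matrix_vector_assoc[symmetric]
        scaleR_diff_right scaleR_add_right add_divide_distrib[symmetric]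
        scaleR_add_left[symmetric] vec_eq_iff divide_simps) (simp add: algebra_simps)
qed

text \<open>On \<open>im P\<close> the involution of \<open>P\<close> is \<open>1\<close>, so \<open>Y\<close> acts there as \<open>(a - b) + 2 b Q\<close>.\<close>

lemma soliton_image:
  assumes "a - b \<noteq> 0" and P: "P ** P = P"
  shows "(\<lambda>v. (mat 1 + (2 * b / (a - b)) *\<^sub>R Q) *v v) ` mat_image P =
         (\<lambda>v. (a *\<^sub>R involution_of P + b *\<^sub>R involution_of Q) *v v) ` mat_image P"
proof (rule image_eq_if_scalar_multiple[OF subspace_mat_image matrix_vector_mul_linear])
  show "1 / (a - b) \<noteq> 0" using assms by simp
  fix v assume "v \<in> mat_image P"
  then have "P *v v = v"
    using P by (auto simp: mat_image_def matrix_vector_mul_assoc)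
  then have "(a *\<^sub>R involution_of P + b *\<^sub>R involution_of Q) *v v =
      (a - b) *\<^sub>R v + (2 * b) *\<^sub>R (Q *v v)"
    by (simp add: involution_of_def matrix_vector_mult_add_rdistrib
        matrix_vector_mult_diff_rdistrib scaleR_matrix_vector_assoc[symmetric] algebra_simps)
      (simp add: vec_eq_iff)
  then show "(mat 1 + (2 * b / (a - b)) *\<^sub>R Q) *v v =
      (1 / (a - b)) *\<^sub>R ((a *\<^sub>R involution_of P + b *\<^sub>R involution_of Q) *v v)"
    using assms
    by (simp add: matrix_vector_mult_add_rdistrib scaleR_matrix_vector_assoc[symmetric]
        scaleR_add_right)
qed

lemma is_projector_with_conjugate:
  assumes Y: "invertible Y" and P: "P ** P = P"
  shows "is_projector_with ((*v) Y ` mat_kernel P) ((*v) Y ` mat_image P) (conjugate Y P)"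
  unfolding is_projector_with_def
proof (intro conjI)
  show "projector (conjugate Y P)"
    using Y P by (simp add: projector_def conjugate_mult)
  have cancel: "Y *v (matrix_inv Y *v v) = v" "matrix_inv Y *v (Y *v v) = v" for v
    using Y by (simp_all add: matrix_vector_mul_assoc matrix_inv_cancel)
  have conj: "conjugate Y P *v v = Y *v (P *v (matrix_inv Y *v v))" for v
    by (simp add: conjugate_def matrix_vector_mul_assoc matrix_mul_assoc)
  have "Y *v w = 0 \<Longrightarrow> w = 0" for w
    using cancel(2)[of w] by simp
  then have "v \<in> mat_kernel (conjugate Y P) \<longleftrightarrow> matrix_inv Y *v v \<in> mat_kernel P" for v
    by (auto simp: mat_kernel_def conj)
  then have "mat_kernel (conjugate Y P) = (*v) (matrix_inv Y) -` mat_kernel P"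
    by blast
  also have "\<dots> = (*v) Y ` mat_kernel P"
  proof (intro equalityI subsetI)
    fix v assume "v \<in> (*v) (matrix_inv Y) -` mat_kernel P"
    then show "v \<in> (*v) Y ` mat_kernel P"
      by (intro image_eqI[of _ _ "matrix_inv Y *v v"]) (simp_all only: cancel vimage_eq)
  qed (auto simp: cancel)
  finally show "mat_kernel (conjugate Y P) = (*v) Y ` mat_kernel P" .
  have "range ((*v) (matrix_inv Y)) = UNIV"
    by (rule surjI) (rule cancel)
  then show "mat_image (conjugate Y P) = (*v) Y ` mat_image P"
    unfolding mat_image_def conj
    using image_image[of "\<lambda>w. Y *v (P *v w)" "(*v) (matrix_inv Y)" UNIV]
    by (simp only: image_image)
qed

text \<open>The kernel and image of a projector span the space. If \<open>Y (ker P)\<close> and \<open>Y (im P)\<close> are such a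
  pair, then \<open>Y\<close> is surjective.\<close>

lemma ex_projector_with_image_iff:
  fixes P Y :: "real^'n^'n"
  assumes P: "P ** P = P"
  shows "(\<exists>Q. is_projector_with ((*v) Y ` mat_kernel P) ((*v) Y ` mat_image P) Q) \<longleftrightarrow> invertible Y"
proof
  assume "\<exists>Q. is_projector_with ((*v) Y ` mat_kernel P) ((*v) Y ` mat_image P) Q"
  then obtain Q where Q: "Q ** Q = Q" "mat_kernel Q = (*v) Y ` mat_kernel P"
      "mat_image Q = (*v) Y ` mat_image P"
    by (auto simp: is_projector_with_def projector_def)
  have "\<exists>w. Y *v w = v" for v
  proof -
    have "v - Q *v v \<in> mat_kernel Q" "Q *v v \<in> mat_image Q"
      using Q(1) by (auto simp: mat_kernel_def mat_image_def matrix_vector_mult_diff_distrib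
          matrix_vector_mul_assoc)
    then obtain w1 w2 where "v - Q *v v = Y *v w1" "Q *v v = Y *v w2"
      unfolding Q by blast
    then have "Y *v (w1 + w2) = v"
      by (simp add: matrix_vector_right_distrib) (metis diff_add_cancel)
    then show ?thesis ..
  qed
  then have "surj ((*v) Y)"
    by (metis surjI)
  then show "invertible Y"
    by (metis invertible_right_inverse matrix_right_invertible_surjective)
next
  assume "invertible Y"
  then show "\<exists>Q. is_projector_with ((*v) Y ` mat_kernel P) ((*v) Y ` mat_image P) Q"
    using is_projector_with_conjugate[OF _ P] by blast
qed

lemma projector_of_involution:
  fixes S :: "real^'n^'n"
  assumes "S \<in> involutions k"
  shows "projector_of S ** projector_of S = projector_of S" "involution_of (projector_of S) = S"
proof -
  obtain P where "S = involution_of P" "P ** P = P"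
    using assms by (auto simp: involutions_def projector_def)
  moreover have "projector_of (involution_of P) = P" for P :: "real^'n^'n"
    by (simp add: projector_of_def involution_of_def)
  ultimately show "projector_of S ** projector_of S = projector_of S"
    "involution_of (projector_of S) = S"
    by simp_all
qed

text \<open>All four subspaces in the definition are images under the single matrix \<open>Y\<close>, which is
  symmetric in the two factors; so one matrix conjugates both involutions.\<close>

lemma soliton_map_eq_conjugate:
  assumes S1: "S1 \<in> involutions k" and S2: "S2 \<in> involutions k'"
    and l: "l1 \<noteq> l2" "l1 \<noteq> - l2"
  defines "Y \<equiv> l1 *\<^sub>R S1 + l2 *\<^sub>R S2"
  shows "soliton_map l1 l2 (S1, S2) =
    (if invertible Y then Some (conjugate Y S1, conjugate Y S2) else None)"
proof -
  let ?P1 = "projector_of S1" and ?P2 = "projector_of S2"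
  note P1 = projector_of_involution[OF S1] and P2 = projector_of_involution[OF S2]
  have l': "l1 + l2 \<noteq> 0" "l1 - l2 \<noteq> 0" "l2 + l1 \<noteq> 0" "l2 - l1 \<noteq> 0"
    using l by auto
  have Y2: "l2 *\<^sub>R S2 + l1 *\<^sub>R S1 = Y"
    by (simp add: Y_def)
  have K1: "(\<lambda>v. (mat 1 - (2 * l2 / (l1 + l2)) *\<^sub>R ?P2) *v v) ` mat_kernel ?P1 =
      (*v) Y ` mat_kernel ?P1"
    using soliton_kernel[OF l'(1), of ?P2 ?P1] by (simp add: P1 P2 Y_def)
  have K2: "(\<lambda>v. (mat 1 - (2 * l1 / (l1 + l2)) *\<^sub>R ?P1) *v v) ` mat_kernel ?P2 =
      (*v) Y ` mat_kernel ?P2"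
    using soliton_kernel[OF l'(3), of ?P1 ?P2] by (simp add: P1 P2 Y2 add.commute[of l2 l1])
  have L1: "(\<lambda>v. (mat 1 + (2 * l2 / (l1 - l2)) *\<^sub>R ?P2) *v v) ` mat_image ?P1 =
      (*v) Y ` mat_image ?P1"
    using soliton_image[OF l'(2) P1(1), of ?P2] by (simp add: P1 P2 Y_def)
  have L2: "(\<lambda>v. (mat 1 + (2 * l1 / (l2 - l1)) *\<^sub>R ?P1) *v v) ` mat_image ?P2 =
      (*v) Y ` mat_image ?P2"
    using soliton_image[OF l'(4) P2(1), of ?P1] by (simp add: P1 P2 Y2)
  have proj: "involution_of (projector_with ((*v) Y ` mat_kernel (projector_of S))
        ((*v) Y ` mat_image (projector_of S))) = conjugate Y S"
    if "invertible Y" "S \<in> involutions m" for S m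
    using projector_with_eq[OF is_projector_with_conjugate[OF that(1) projector_of_involution(1)[OF that(2)]]]
    by (simp add: conjugate_involution_of[OF that(1), symmetric] projector_of_involution(2)[OF that(2)])
  show ?thesis
    unfolding soliton_map_def Let_def prod.case K1 K2 L1 L2
      ex_projector_with_image_iff[OF P1(1)] ex_projector_with_image_iff[OF P2(1)]
    using proj S1 S2 by auto
qed


section \<open>The symplectic form under a simultaneous conjugation\<close>

lemma trace_minus: "trace (- A) = - trace (A :: real^'n^'n)"
  by (simp add: trace_def sum_negf)

lemma trace_scaleR: "trace (c *\<^sub>R A) = c * trace (A :: real^'n^'n)"
  by (simp add: trace_def sum_distrib_left)

text \<open>To first order in \<open>X\<close>, conjugation by \<open>1 + X\<close> moves \<open>S\<close> by \<open>[X, S]\<close>. Moving \<open>S\<close> past the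
  anticommuting \<open>U\<close> and \<open>V\<close> and rotating under the trace brings every monomial of the expansion
  to one of the forms on the right.\<close>

lemma trace_commutator_shift:
  fixes S U V X Y :: "real^'n^'n"
  assumes S: "S ** S = mat 1" and U: "U ** S + S ** U = 0" and V: "V ** S + S ** V = 0"
  shows "trace (S ** (U + (X ** S - S ** X)) ** (V + (Y ** S - S ** Y))) =
    trace (S ** U ** V) + 2 * (trace (U ** Y) - trace (X ** V) + trace (S ** (Y ** X - X ** Y)))"
proof -
  have SS: "S ** (S ** A) = A" for A :: "real^'n^'n"
    by (simp add: matrix_mul_assoc S)
  have US: "U ** S = - (S ** U)" and VS: "V ** S = - (S ** V)"
    using U V by (simp_all add: eq_neg_iff_add_eq_0)
  have USA: "S ** (U ** (S ** A)) = - (U ** A)" for A :: "real^'n^'n"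
  proof -
    have "S ** (U ** (S ** A)) = S ** ((U ** S) ** A)"
      by (simp add: matrix_mul_assoc)
    also have "\<dots> = - (S ** (S ** (U ** A)))"
      unfolding US by (simp only: matrix_mult.minus_left matrix_mult.minus_right matrix_mul_assoc)
    finally show ?thesis by (simp only: SS)
  qed
  have 1: "trace (S ** (U ** (Y ** S))) = trace (U ** Y)"
    using trace_mul_sym[of "S ** (U ** Y)" S] SS by (simp add: matrix_mul_assoc)
  have 2: "trace (S ** (X ** (S ** V))) = - trace (X ** V)"
  proof -
    have "trace (S ** (X ** (S ** V))) = trace (X ** (S ** (V ** S)))"
      using trace_mul_sym[of S "X ** (S ** V)"] by (simp add: matrix_mul_assoc)
    then show ?thesis
      by (simp add: VS matrix_mult.minus_right SS trace_minus)
  qed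
  have 3: "trace (S ** (X ** (S ** (Y ** S)))) = trace (S ** (Y ** X))"
  proof -
    have "trace (S ** (X ** (S ** (Y ** S)))) = trace (X ** (S ** Y))"
      using trace_mul_sym[of "S ** (X ** (S ** Y))" S] SS by (simp add: matrix_mul_assoc)
    also have "\<dots> = trace (S ** (Y ** X))"
      using trace_mul_sym[of X "S ** Y"] by (simp add: matrix_mul_assoc)
    finally show ?thesis .
  qed
  have 4: "trace (X ** (Y ** S)) = trace (S ** (X ** Y))"
    using trace_mul_sym[of "X ** Y" S] by (simp add: matrix_mul_assoc)
  have 5: "trace (X ** (S ** Y)) = trace (S ** (Y ** X))"
    using trace_mul_sym[of X "S ** Y"] by (simp add: matrix_mul_assoc)
  show ?thesis
    by (simp add: matrix_mult.add_left matrix_mult.add_right matrix_mult.diff_left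
        matrix_mult.diff_right matrix_mul_assoc[symmetric] SS USA trace_add trace_sub trace_minus
        1 2 3 4 5)
qed

text \<open>The derivative of \<open>(Y, A) \<mapsto> Y A Y\<^sup>-\<^sup>1\<close> in the direction \<open>(dY, dA)\<close>, written as a conjugate so
  that traces of products reduce to the point before conjugation.\<close>

definition conjugate_deriv ::
    "real^'n^'n \<Rightarrow> real^'n^'n \<Rightarrow> real^'n^'n \<Rightarrow> real^'n^'n \<Rightarrow> real^'n^'n" where
  "conjugate_deriv Y A dY dA =
    conjugate Y (dA + (matrix_inv Y ** dY ** A - A ** (matrix_inv Y ** dY)))"

text \<open>The failure of a conjugation by a moving \<open>Y\<close> to preserve the form, for one factor. The
  parameter \<open>l\<close> is kept next to \<open>S\<close>, \<open>U\<close> and \<open>V\<close> because the right-hand side is linear in the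
  scaled triple for fixed \<open>X\<close> and \<open>Z\<close>, and these triples are what adds up to \<open>Y\<close> and its variations.\<close>

lemma involution_form_conjugate_deriv:
  fixes S U V Y :: "real^'n^'n"
  assumes Y: "invertible Y"
    and S: "S \<in> involutions k"
    and U: "U \<in> tangent_space (involutions k) S" and V: "V \<in> tangent_space (involutions k) S"
    and U': "conjugate_deriv Y S dY U \<in> tangent_space (involutions k) (conjugate Y S)"
    and V': "conjugate_deriv Y S dY' V \<in> tangent_space (involutions k) (conjugate Y S)"
  defines "X \<equiv> matrix_inv Y ** dY" and "Z \<equiv> matrix_inv Y ** dY'"
  shows "involution_form l (conjugate Y S) (conjugate_deriv Y S dY U) (conjugate_deriv Y S dY' V) -
      involution_form l S U V =
    trace (X ** (l *\<^sub>R V)) - trace ((l *\<^sub>R U) ** Z) - trace ((l *\<^sub>R S) ** (Z ** X - X ** Z))"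
proof -
  note SS = involution_square[OF S]
  note form = involution_form_eq[OF SS tangent_involutions[OF U] tangent_involutions[OF V]]
  have form': "involution_form l (conjugate Y S) (conjugate_deriv Y S dY U) (conjugate_deriv Y S dY' V) =
      - (l / 2) * trace (conjugate Y S ** conjugate_deriv Y S dY U ** conjugate_deriv Y S dY' V)"
    using involution_form_eq[OF involution_square[OF conjugate_in_involutions[OF Y S]]
        tangent_involutions[OF U'] tangent_involutions[OF V']] .
  have trace': "trace (conjugate Y S ** conjugate_deriv Y S dY U ** conjugate_deriv Y S dY' V) =
      trace (S ** U ** V) + 2 * (trace (U ** Z) - trace (X ** V) + trace (S ** (Z ** X - X ** Z)))"
    unfolding conjugate_deriv_def conjugate_mult[OF Y] trace_conjugate[OF Y]
      X_def[symmetric] Z_def[symmetric]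
    by (rule trace_commutator_shift[OF SS tangent_involutions[OF U] tangent_involutions[OF V]])
  show ?thesis
    unfolding form form' trace'
    by (simp add: matrix_mult.scaleR_left matrix_mult.scaleR_right trace_scaleR algebra_simps)
qed

section \<open>Differentiability of the matrix inverse\<close>

lemma open_invertible: "open {Y :: real^'n^'n. invertible Y}"
proof -
  have "continuous_on UNIV (det :: real^'n^'n \<Rightarrow> real)"
    unfolding det_def by (intro continuous_intros)
  then have "open {Y :: real^'n^'n. det Y \<noteq> 0}"
    by (intro open_Collect_neq continuous_intros)
  then show ?thesis
    by (simp add: invertible_det_nz)
qed

text \<open>From \<open>Z\<^sup>-\<^sup>1 - Y\<^sup>-\<^sup>1 = - Z\<^sup>-\<^sup>1 (Z - Y) Y\<^sup>-\<^sup>1\<close>, used twice, the remainder of the linear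
  approximation is \<open>Z\<^sup>-\<^sup>1 (Z - Y) Y\<^sup>-\<^sup>1 (Z - Y) Y\<^sup>-\<^sup>1\<close>. It is of second order because \<open>Z\<^sup>-\<^sup>1\<close> is
  bounded near \<open>Y\<close>.\<close>

lemma has_derivative_matrix_inv:
  fixes Y :: "real^'n^'n"
  assumes Y: "invertible Y"
  shows "(matrix_inv has_derivative (\<lambda>H. - (matrix_inv Y ** H ** matrix_inv Y))) (at Y)"
proof -
  let ?J = "matrix_inv Y"
  obtain K where K: "K > 0"
      "\<And>(A :: real^'n^'n) (B :: real^'n^'n). norm (A ** B) \<le> norm A * norm B * K"
    using matrix_mult.pos_bounded by blast
  have K3: "norm (A ** B ** C) \<le> norm A * norm B * norm C * K\<^sup>2" for A B C :: "real^'n^'n"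
  proof -
    have "norm (A ** B ** C) \<le> norm (A ** B) * norm C * K" by (rule K)
    also have "\<dots> \<le> norm A * norm B * K * norm C * K"
      using K by (intro mult_right_mono) auto
    finally show ?thesis by (simp add: power2_eq_square mult_ac)
  qed
  obtain d where d: "d > 0" "\<And>Z. dist Z Y < d \<Longrightarrow> invertible Z"
    using open_invertible[where 'n='n] Y unfolding open_dist by blast
  (* The radius makes the correction term in the identity for the inverse of Z at most half of the
     norm of that inverse, so that it can be absorbed on the left. *)
  define e where "e = min d (1 / (2 * (norm ?J + 1) * K\<^sup>2))"
  have e: "e > 0" "e * (norm ?J * K\<^sup>2) \<le> 1 / 2"
  proof -
    show "e > 0"
      unfolding e_def using d K by (simp add: add_nonneg_pos)
    have "e * (norm ?J * K\<^sup>2) \<le> 1 / (2 * (norm ?J + 1) * K\<^sup>2) * (norm ?J * K\<^sup>2)"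
      unfolding e_def by (intro mult_right_mono) auto
    also have "\<dots> \<le> 1 / 2"
      using K by (simp add: divide_simps add_nonneg_eq_0_iff not_less add_nonneg_nonneg)
    finally show "e * (norm ?J * K\<^sup>2) \<le> 1 / 2" .
  qed
  have step: "norm (matrix_inv Z - ?J - - (?J ** (Z - Y) ** ?J)) / norm (Z - Y)
      \<le> 2 * norm ?J ^ 3 * K ^ 4 * norm (Z - Y)" if Z: "dist Z Y < e" "Z \<noteq> Y" for Z
  proof -
    let ?L = "matrix_inv Z" and ?H = "Z - Y"
    have invZ: "invertible Z"
      using d(2) Z by (simp add: e_def)
    have diff: "?L - ?J = - (?L ** ?H ** ?J)"
      using Y invZ
      by (simp add: matrix_mult.diff_left matrix_mult.diff_right matrix_mul_assoc[symmetric]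
          matrix_inv_cancel matrix_inv_cancel_left)
    have rest: "?L - ?J - - (?J ** ?H ** ?J) = ?L ** ?H ** ?J ** ?H ** ?J"
    proof -
      have "?L - ?J - - (?J ** ?H ** ?J) = ?J ** ?H ** ?J - ?L ** ?H ** ?J"
        by (simp add: diff)
      also have "\<dots> = - ((?L - ?J) ** ?H ** ?J)"
        by (simp add: matrix_mult.diff_left)
      finally show ?thesis
        by (simp only: diff matrix_mult.minus_left minus_minus)
    qed
    have "norm ?L \<le> norm ?J + norm (?L - ?J)"
      using norm_triangle_ineq[of ?J "?L - ?J"] by simp
    also have "norm (?L - ?J) \<le> norm ?L * (norm ?H * (norm ?J * K\<^sup>2))"
      using K3[of ?L ?H ?J] by (simp add: diff mult_ac)
    also have "\<dots> \<le> norm ?L * (e * (norm ?J * K\<^sup>2))"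
      using Z by (intro mult_left_mono mult_right_mono) (auto simp: dist_norm)
    also have "\<dots> \<le> norm ?L * (1 / 2)"
      using e by (intro mult_left_mono) auto
    finally have L: "norm ?L \<le> 2 * norm ?J" by simp
    have "norm (?L ** ?H ** ?J ** ?H ** ?J) \<le> norm (?L ** ?H ** ?J) * norm ?H * norm ?J * K\<^sup>2"
      by (rule K3)
    also have "\<dots> \<le> (norm ?L * norm ?H * norm ?J * K\<^sup>2) * norm ?H * norm ?J * K\<^sup>2"
      using K3[of ?L ?H ?J] by (intro mult_right_mono) auto
    also have "\<dots> \<le> (2 * norm ?J * norm ?H * norm ?J * K\<^sup>2) * norm ?H * norm ?J * K\<^sup>2"
      using L by (intro mult_right_mono) auto
    also have "\<dots> = (2 * norm ?J ^ 3 * K ^ 4 * norm ?H) * norm ?H"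
      by (simp add: power_numeral_reduce mult_ac)
    finally show ?thesis
      unfolding rest using Z by (simp add: divide_le_eq)
  qed
  show ?thesis
  proof (rule has_derivativeI_sandwich[OF e(1)])
    show "bounded_linear (\<lambda>H. - (?J ** H ** ?J))"
      by (intro bounded_linear_minus bounded_linear_compose[OF matrix_mult.bounded_linear_left]
          matrix_mult.bounded_linear_right)
    show "((\<lambda>Z. 2 * norm ?J ^ 3 * K ^ 4 * norm (Z - Y)) \<longlongrightarrow> 0) (at Y)"
      by (rule tendsto_eq_intros | simp)+
  qed (use step in auto)
qed

section \<open>Maps preserving a two-form\<close>

text \<open>Curves are pushed forward by \<open>f\<close>. Only points of \<open>M\<close> inside \<open>U\<close> are known to land in \<open>M'\<close>, so
  the curve is shortened until it stays in \<open>U\<close>.\<close>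

lemma tangent_space_image:
  assumes u: "u \<in> tangent_space M x" and f: "(f has_derivative D) (at x)"
    and U: "open U" "x \<in> U" and M: "\<And>y. y \<in> M \<inter> U \<Longrightarrow> f y \<in> M'"
  shows "D u \<in> tangent_space M' (f x)"
proof -
  obtain c e where e: "e > 0" and c: "\<And>t. t \<in> {-e<..<e} \<Longrightarrow> c t \<in> M" and c0: "c 0 = x"
    and d: "(c has_vector_derivative u) (at (0::real))"
    using u unfolding tangent_space_def by blast
  have "(c \<longlongrightarrow> c 0) (at 0)"
    using has_vector_derivative_continuous[OF d] by (simp add: isCont_def)
  then have "\<forall>\<^sub>F t in at 0. c t \<in> U"
    using U c0 by (auto dest: topological_tendstoD)
  then obtain r where r: "r > 0" "\<And>t. t \<noteq> 0 \<Longrightarrow> dist t 0 < r \<Longrightarrow> c t \<in> U"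
    unfolding eventually_at by auto
  have "f (c t) \<in> M'" if "t \<in> {- min e r<..<min e r}" for t
    using that c[of t] r(2)[of t] U(2) c0 by (cases "t = 0") (auto intro!: M simp: dist_real_def)
  moreover have "((\<lambda>t. f (c t)) has_vector_derivative D u) (at 0)"
  proof -
    have "((\<lambda>t. f (c t)) has_derivative (\<lambda>t. D (t *\<^sub>R u))) (at 0)"
      using has_derivative_compose[OF d[unfolded has_vector_derivative_def]] f c0 by simp
    then show ?thesis
      by (simp add: has_vector_derivative_def linear_cmul[OF has_derivative_linear[OF f]])
  qed
  ultimately show ?thesis
    unfolding tangent_space_def using e r c0
    by (auto intro!: exI[of _ "\<lambda>t. f (c t)"] exI[of _ "min e r"])
qed

text \<open>A criterion for maps that extend smoothly to a neighbourhood in the ambient space. That the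
  derivative maps tangent vectors to tangent vectors is automatic, so it may be assumed when the
  two values of the form are compared.\<close>

lemma preserves_formI:
  assumes U: "open U" and dom: "M \<inter> dom T = M \<inter> U"
    and T: "\<And>x. x \<in> M \<inter> U \<Longrightarrow> T x = Some (f x)"
    and fM: "\<And>x. x \<in> M \<inter> U \<Longrightarrow> f x \<in> M"
    and D: "\<And>x. x \<in> M \<inter> U \<Longrightarrow> (f has_derivative D x) (at x)"
    and form: "\<And>x u v. x \<in> M \<inter> U \<Longrightarrow> u \<in> tangent_space M x \<Longrightarrow> v \<in> tangent_space M x \<Longrightarrow>
      D x u \<in> tangent_space M (f x) \<Longrightarrow> D x v \<in> tangent_space M (f x) \<Longrightarrow>
      \<Omega> (f x) (D x u) (D x v) = \<Omega> x u v"
  shows "preserves_form M \<Omega> T"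
  unfolding preserves_form_def dom
proof (intro conjI ballI)
  show "openin (top_of_set M) (M \<inter> U)"
    using U by (rule openin_open_Int)
  fix x assume x: "x \<in> M \<inter> U"
  then show "the (T x) \<in> M" using T fM by simp
  have tangent: "D x u \<in> tangent_space M (f x)" if "u \<in> tangent_space M x" for u
    using tangent_space_image[OF that D[OF x] U _ fM] x by blast
  have "((\<lambda>y. the (T y)) has_derivative D x) (at x within M \<inter> U)"
    using has_derivative_transform[OF x _ has_derivative_at_withinI[OF D[OF x]]] T by simp
  then show "\<exists>D. ((\<lambda>y. the (T y)) has_derivative D) (at x within M \<inter> U) \<and>
      (\<forall>u\<in>tangent_space M x. \<forall>v\<in>tangent_space M x. D u \<in> tangent_space M (the (T x)) \<and>
        \<Omega> (the (T x)) (D u) (D v) = \<Omega> x u v)"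
    using tangent form[OF x] T[OF x] by auto
qed

lemma preserves_form_Some: "preserves_form M \<Omega> Some"
  by (rule preserves_formI[where U = UNIV and f = "\<lambda>x. x" and D = "\<lambda>x h. h"]) auto

text \<open>The chain rule within the domains. The domain of the composition is the preimage of one
  relatively open set under a map continuous on another, hence relatively open.\<close>

lemma preserves_form_comp:
  assumes f: "preserves_form M \<Omega> f" and g: "preserves_form M \<Omega> g"
  shows "preserves_form M \<Omega> (g \<circ>\<^sub>m f)"
proof -
  let ?f = "\<lambda>x. the (f x)" and ?g = "\<lambda>x. the (g x)"
  let ?A = "M \<inter> dom f" and ?B = "M \<inter> dom g" and ?C = "M \<inter> dom (g \<circ>\<^sub>m f)"
  have openA: "openin (top_of_set M) ?A" and openB: "openin (top_of_set M) ?B"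
    using f g by (auto simp: preserves_form_def)
  have fM: "\<And>x. x \<in> ?A \<Longrightarrow> ?f x \<in> M" and gM: "\<And>x. x \<in> ?B \<Longrightarrow> ?g x \<in> M"
    using f g by (auto simp: preserves_form_def)
  have C: "?C = ?A \<inter> ?f -` ?B"
    using fM by (force simp: map_comp_def split: option.splits)
  have val: "the ((g \<circ>\<^sub>m f) x) = ?g (?f x)" if "x \<in> ?C" for x
    using that by (auto simp: map_comp_def split: option.splits)
  have "continuous_on ?A ?f"
    unfolding continuous_on_eq_continuous_within
  proof
    fix x assume "x \<in> ?A"
    then obtain D where "(?f has_derivative D) (at x within ?A)"
      using f unfolding preserves_form_def by blast
    then show "continuous (at x within ?A) ?f"
      by (rule has_derivative_continuous)
  qed
  then have "openin (top_of_set ?A) ?C"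
    unfolding C using fM openB by (intro continuous_openin_preimage) auto
  then have openC: "openin (top_of_set M) ?C"
    using openA by (rule openin_trans)
  show ?thesis
    unfolding preserves_form_def
  proof (intro conjI openC ballI)
    fix x assume x: "x \<in> ?C"
    then have xA: "x \<in> ?A" and fxB: "?f x \<in> ?B" unfolding C by auto
    show "the ((g \<circ>\<^sub>m f) x) \<in> M"
      using val[OF x] gM[OF fxB] by simp
    obtain D where D: "(?f has_derivative D) (at x within ?A)"
      and Dform: "\<And>u v. u \<in> tangent_space M x \<Longrightarrow> v \<in> tangent_space M x \<Longrightarrow>
        D u \<in> tangent_space M (?f x) \<and> \<Omega> (?f x) (D u) (D v) = \<Omega> x u v"
      using f xA unfolding preserves_form_def by meson
    obtain E where E: "(?g has_derivative E) (at (?f x) within ?B)"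
      and Eform: "\<And>u v. u \<in> tangent_space M (?f x) \<Longrightarrow> v \<in> tangent_space M (?f x) \<Longrightarrow>
        E u \<in> tangent_space M (?g (?f x)) \<and> \<Omega> (?g (?f x)) (E u) (E v) = \<Omega> (?f x) u v"
      using g fxB unfolding preserves_form_def by meson
    have "((\<lambda>y. ?g (?f y)) has_derivative (\<lambda>h. E (D h))) (at x within ?C)"
    proof (rule has_derivative_in_compose[where f = "?f" and g = "?g" and f' = D and g' = E])
      show "(?f has_derivative D) (at x within ?C)"
        using D C by (auto intro: has_derivative_subset)
      show "(?g has_derivative E) (at (?f x) within ?f ` ?C)"
        using E C by (auto intro: has_derivative_subset)
    qed
    then have deriv: "((\<lambda>y. the ((g \<circ>\<^sub>m f) y)) has_derivative (\<lambda>h. E (D h))) (at x within ?C)"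
      by (rule has_derivative_transform[OF x, rotated]) (rule val)
    have tangent: "D u \<in> tangent_space M (?f x)" "E (D u) \<in> tangent_space M (?g (?f x))"
      if "u \<in> tangent_space M x" for u
      using that Dform Eform by blast+
    show "\<exists>D. ((\<lambda>y. the ((g \<circ>\<^sub>m f) y)) has_derivative D) (at x within ?C) \<and>
        (\<forall>u\<in>tangent_space M x. \<forall>v\<in>tangent_space M x. D u \<in> tangent_space M (the ((g \<circ>\<^sub>m f) x)) \<and>
          \<Omega> (the ((g \<circ>\<^sub>m f) x)) (D u) (D v) = \<Omega> x u v)"
      unfolding val[OF x]
      by (intro exI[of _ "\<lambda>h. E (D h)"] conjI ballI deriv) (simp_all add: tangent Dform Eform)
  qed
qed

section \<open>One interaction preserves the phase form\<close>

lemma has_derivative_vec_lambda: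
  fixes f :: "'m::finite \<Rightarrow> 'a::euclidean_space \<Rightarrow> 'b::real_normed_vector"
  assumes "\<And>m. (f m has_derivative f' m) F"
  shows "((\<lambda>x. \<chi> m. f m x) has_derivative (\<lambda>h. \<chi> m. f' m h)) F"
  unfolding has_derivative_def
proof
  have "linear (f' m)" for m
    using assms by (rule has_derivative_linear)
  then have "linear (\<lambda>h. \<chi> m. f' m h)"
    by (intro linearI) (simp_all add: vec_eq_iff linear_add linear_cmul)
  then show "bounded_linear (\<lambda>h. \<chi> m. f' m h)"
    by (simp add: linear_conv_bounded_linear)
  show "((\<lambda>y. ((\<chi> m. f m y) - (\<chi> m. f m (Lim F (\<lambda>x. x))) - (\<chi> m. f' m (y - Lim F (\<lambda>x. x)))) /\<^sub>R
      norm (y - Lim F (\<lambda>x. x))) \<longlongrightarrow> 0) F"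
    using assms by (intro vec_tendstoI) (simp add: has_derivative_def)
qed

lemma tangent_phase_space_nth:
  assumes "U \<in> tangent_space (phase_space k) S"
  shows "U $ m \<in> tangent_space (involutions k) (S $ m)"
  using tangent_space_image[OF assms bounded_linear_imp_has_derivative[OF bounded_linear_vec_nth] open_UNIV]
  by (auto simp: phase_space_def)

definition pair_sum ::
    "('m::finite \<Rightarrow> real) \<Rightarrow> 'm \<Rightarrow> 'm \<Rightarrow> (real^'n^'n)^'m \<Rightarrow> real^'n^'n" where
  "pair_sum l i j S = l i *\<^sub>R S $ i + l j *\<^sub>R S $ j"

lemma bounded_linear_pair_sum: "bounded_linear (pair_sum l i j)"
  unfolding pair_sum_def
  by (intro bounded_linear_add bounded_linear_const_scaleR bounded_linear_vec_nth)

text \<open>The interaction of the factors \<open>i\<close> and \<open>j\<close> without its domain condition: a map of the whole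
  ambient space, differentiable wherever the pair sum is invertible.\<close>

definition exchange ::
    "('m::finite \<Rightarrow> real) \<Rightarrow> 'm \<Rightarrow> 'm \<Rightarrow> (real^'n^'n)^'m \<Rightarrow> (real^'n^'n)^'m" where
  "exchange l i j S = (\<chi> m. if m \<in> {i, j} then conjugate (pair_sum l i j S) (S $ m) else S $ m)"

definition exchange_deriv ::
    "('m::finite \<Rightarrow> real) \<Rightarrow> 'm \<Rightarrow> 'm \<Rightarrow> (real^'n^'n)^'m \<Rightarrow> (real^'n^'n)^'m \<Rightarrow> (real^'n^'n)^'m" where
  "exchange_deriv l i j S H =
    (\<chi> m. if m \<in> {i, j} then conjugate_deriv (pair_sum l i j S) (S $ m) (pair_sum l i j H) (H $ m)
      else H $ m)"

lemma factor_map_eq_exchange: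
  assumes S: "S \<in> phase_space k" and l: "l i \<noteq> l j" "l i \<noteq> - l j"
  shows "factor_map l i j S = (if invertible (pair_sum l i j S) then Some (exchange l i j S) else None)"
proof -
  have "S $ i \<in> involutions k" "S $ j \<in> involutions k"
    using S by (auto simp: phase_space_def)
  then show ?thesis
    unfolding factor_map_def
    using soliton_map_eq_conjugate[of "S $ i" k "S $ j" k "l i" "l j"] l
    by (auto simp: pair_sum_def exchange_def vec_eq_iff)
qed

lemma exchange_in_phase_space:
  assumes "S \<in> phase_space k" "invertible (pair_sum l i j S)"
  shows "exchange l i j S \<in> phase_space k"
  using assms by (auto simp: phase_space_def exchange_def conjugate_in_involutions)

lemma has_derivative_exchange:
  fixes S :: "(real^'n^'n)^'m::finite"
  assumes inv: "invertible (pair_sum l i j S)"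
  shows "(exchange l i j has_derivative exchange_deriv l i j S) (at S)"
proof -
  let ?Y = "pair_sum l i j" and ?J = "matrix_inv (pair_sum l i j S)"
  have Y: "(?Y has_derivative ?Y) (at S)"
    by (rule bounded_linear_imp_has_derivative[OF bounded_linear_pair_sum])
  have nth: "((\<lambda>S. S $ m) has_derivative (\<lambda>H. H $ m)) (at S)" for m
    by (rule bounded_linear_imp_has_derivative[OF bounded_linear_vec_nth])
  have "((\<lambda>S. conjugate (?Y S) (S $ m)) has_derivative
      (\<lambda>H. conjugate_deriv (?Y S) (S $ m) (?Y H) (H $ m))) (at S)" for m
    unfolding conjugate_def
    by (rule has_derivative_eq_rhs[OF matrix_mult.FDERIV[OF matrix_mult.FDERIV[OF Y nth]
          has_derivative_compose[OF Y has_derivative_matrix_inv[OF inv]]]])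
      (use inv in \<open>simp add: fun_eq_iff conjugate_deriv_def conjugate_def matrix_mult.add_left
        matrix_mult.add_right matrix_mult.diff_left matrix_mult.diff_right matrix_mult.minus_right
        matrix_mul_assoc[symmetric] matrix_inv_cancel_left\<close>)
  then have "((\<lambda>S. if m \<in> {i, j} then conjugate (?Y S) (S $ m) else S $ m) has_derivative
      (\<lambda>H. if m \<in> {i, j} then conjugate_deriv (?Y S) (S $ m) (?Y H) (H $ m) else H $ m)) (at S)" for m
    using nth by (cases "m \<in> {i, j}") auto
  then show ?thesis
    unfolding exchange_def[abs_def] exchange_deriv_def[abs_def] by (rule has_derivative_vec_lambda)
qed

text \<open>The defects of the two factors cancel: they are linear in the scaled data, whose sums over
  \<open>i\<close> and \<open>j\<close> are \<open>Y\<close>, \<open>Y X\<close> and \<open>Y Z\<close>.\<close>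

lemma phase_form_exchange:
  fixes S U V :: "(real^'n^'n)^('m::nontriv mod_ring)"
  assumes ij: "i \<noteq> j" and S: "S \<in> phase_space k" and inv: "invertible (pair_sum l i j S)"
    and U: "U \<in> tangent_space (phase_space k) S" and V: "V \<in> tangent_space (phase_space k) S"
    and U': "exchange_deriv l i j S U \<in> tangent_space (phase_space k) (exchange l i j S)"
    and V': "exchange_deriv l i j S V \<in> tangent_space (phase_space k) (exchange l i j S)"
  shows "phase_form l (exchange l i j S) (exchange_deriv l i j S U) (exchange_deriv l i j S V) =
    phase_form l S U V"
proof -
  define Y where "Y = pair_sum l i j S"
  define X where "X = matrix_inv Y ** pair_sum l i j U"
  define Z where "Z = matrix_inv Y ** pair_sum l i j V"
  let ?d = "\<lambda>m. involution_form (l m) (exchange l i j S $ m) (exchange_deriv l i j S U $ m)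
      (exchange_deriv l i j S V $ m) - involution_form (l m) (S $ m) (U $ m) (V $ m)"
  have YX: "pair_sum l i j U = Y ** X" and YZ: "pair_sum l i j V = Y ** Z"
    using inv by (simp_all add: X_def Z_def Y_def matrix_inv_cancel_left)
  have d: "?d m = trace (X ** (l m *\<^sub>R V $ m)) - trace ((l m *\<^sub>R U $ m) ** Z)
      - trace ((l m *\<^sub>R S $ m) ** (Z ** X - X ** Z))" if m: "m \<in> {i, j}" for m
  proof -
    have eqs: "exchange l i j S $ m = conjugate Y (S $ m)"
      "exchange_deriv l i j S U $ m = conjugate_deriv Y (S $ m) (pair_sum l i j U) (U $ m)"
      "exchange_deriv l i j S V $ m = conjugate_deriv Y (S $ m) (pair_sum l i j V) (V $ m)"
      using m by (auto simp: exchange_def exchange_deriv_def Y_def)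
    have "S $ m \<in> involutions k" using S by (simp add: phase_space_def)
    then show ?thesis
      unfolding eqs X_def Z_def
      using involution_form_conjugate_deriv[OF inv[folded Y_def] _ tangent_phase_space_nth[OF U]
          tangent_phase_space_nth[OF V] tangent_phase_space_nth[OF U', of m, unfolded eqs]
          tangent_phase_space_nth[OF V', of m, unfolded eqs]]
      by blast
  qed
  have "phase_form l (exchange l i j S) (exchange_deriv l i j S U) (exchange_deriv l i j S V) -
      phase_form l S U V = sum ?d UNIV"
    by (simp add: phase_form_def sum_subtractf)
  also have "\<dots> = sum ?d {i, j}"
    by (rule sum.mono_neutral_right) (auto simp: exchange_def exchange_deriv_def)
  also have "\<dots> = trace (X ** pair_sum l i j V) - trace (pair_sum l i j U ** Z)
      - trace (Y ** (Z ** X - X ** Z))"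
    using ij
    by (simp add: d del: insert_iff) (simp add: Y_def pair_sum_def matrix_mult.add_left
      matrix_mult.add_right trace_add)
  also have "\<dots> = 0"
    using trace_mul_sym[of X "Y ** Z"]
    by (simp add: YX YZ matrix_mult.diff_right trace_sub matrix_mul_assoc)
  finally show ?thesis by simp
qed

lemma preserves_form_factor_map:
  fixes l :: "'m::nontriv mod_ring \<Rightarrow> real"
  assumes "i \<noteq> j" "l i \<noteq> l j" "l i \<noteq> - l j"
  shows "preserves_form (phase_space k :: ((real^'n^'n)^('m mod_ring)) set) (phase_form l)
    (factor_map l i j)"
proof (rule preserves_formI[where U = "{S. invertible (pair_sum l i j S)}"
      and f = "exchange l i j" and D = "exchange_deriv l i j"])
  show "open {S :: (real^'n^'n)^('m mod_ring). invertible (pair_sum l i j S)}"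
    using open_vimage[OF open_invertible linear_continuous_on[OF bounded_linear_pair_sum]]
    by (simp add: vimage_def)
qed (use assms in \<open>auto simp: factor_map_eq_exchange exchange_in_phase_space
    has_derivative_exchange phase_form_exchange split: if_splits\<close>)

section \<open>Transfer maps\<close>

text \<open>This keeps the two indices \<open>i\<close> and \<open>i + m\<close> of each interaction distinct.\<close>

lemma of_nat_mod_ring_neq_0:
  assumes "0 < m" "m < CARD('m::nontriv)"
  shows "(of_nat m :: 'm mod_ring) \<noteq> 0"
  using assms by (simp add: of_nat_eq_0_iff_char_dvd nat_dvd_not_less)

lemma preserves_form_partial_transfer:
  fixes l :: "'m::nontriv mod_ring \<Rightarrow> real"
  assumes l: "\<And>i j. i \<noteq> j \<Longrightarrow> l i \<noteq> l j \<and> l i \<noteq> - l j" and "m < CARD('m)"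
  shows "preserves_form (phase_space k :: ((real^'n^'n)^('m mod_ring)) set) (phase_form l)
    (partial_transfer l i m)"
  using assms(2)
proof (induction m)
  case 0
  show ?case unfolding partial_transfer.simps by (rule preserves_form_Some)
next
  case (Suc m)
  have "i \<noteq> i + of_nat (Suc m)"
    using of_nat_mod_ring_neq_0[of "Suc m", where 'm='m] Suc.prems by simp
  then have "preserves_form (phase_space k :: ((real^'n^'n)^('m mod_ring)) set) (phase_form l)
      (factor_map l i (i + of_nat (Suc m)))"
    using l by (intro preserves_form_factor_map) blast+
  then show ?case
    unfolding partial_transfer.simps
    using Suc by (intro preserves_form_comp) simp_all
qed

theorem theorem2:
  fixes l :: "'m::nontriv mod_ring \<Rightarrow> real"
    and k :: nat
    and i :: "'m mod_ring"
  assumes "1 \<le> k" and "k \<le> CARD('n::finite) - 1"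
    and "\<And>i. l i \<noteq> 0"
    and "\<And>i j. i \<noteq> j \<Longrightarrow> l i \<noteq> l j \<and> l i \<noteq> - l j"
  shows "preserves_form (phase_space k :: ((real^'n^'n)^('m mod_ring)) set) (phase_form l)
           (transfer_map l i)"
  unfolding transfer_map_def
  using assms(4) by (rule preserves_form_partial_transfer) simp_all

end
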